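(* Let $s>0$ and let $E\subseteq2^\omega$ be a (lightface) $\Sigma^1_1$ class that is not $\sigma$-finite for $\mathcal H^s$, i.e. $E$ is not a countable union of $\mathcal H^s$-measurable sets of finite $\mathcal H^s$-measure. Then there is a closed set $C\subseteq E$ with $\mathcal H^s(C)=\infty$.
   Context: Cantor space $2^\omega$ carries the metric $d(x,y)=2^{-\min\{n:x(n)\ne y(n)\}}$ for $x\ne y$ and $d(x,x)=0$; $\mathcal H^s$ denotes $s$-dimensional Hausdorff measure with respect to this metric. *)

theory Defs
  imports "HOL-Analysis.Analysis" "HOL-Library.Nat_Bijection"
begin

definition cantor_dist :: "(nat \<Rightarrow> bool) \<Rightarrow> (nat \<Rightarrow> bool) \<Rightarrow> real" where
  "cantor_dist x y = (if x = y then 0 else (1/2) ^ (LEAST n. x n \<noteq> y n))"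

definition cantor_diam :: "(nat \<Rightarrow> bool) set \<Rightarrow> real" where
  "cantor_diam U = (if U = {} then 0 else Sup {cantor_dist x y | x y. x \<in> U \<and> y \<in> U})"

definition cantor_closed :: "(nat \<Rightarrow> bool) set \<Rightarrow> bool" where
  "cantor_closed C \<longleftrightarrow> (\<forall>x. (\<forall>e>0. \<exists>y\<in>C. cantor_dist x y < e) \<longrightarrow> x \<in> C)"

definition hausdorff_pre :: "real \<Rightarrow> real \<Rightarrow> (nat \<Rightarrow> bool) set \<Rightarrow> ennreal" where
  "hausdorff_pre s \<delta> A =
     (INF U \<in> {U :: nat \<Rightarrow> (nat \<Rightarrow> bool) set.
                 A \<subseteq> (\<Union>i. U i) \<and> (\<forall>i. cantor_diam (U i) \<le> \<delta>)}.
        (\<Sum>i. ennreal (cantor_diam (U i) powr s)))"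

definition hausdorff :: "real \<Rightarrow> (nat \<Rightarrow> bool) set \<Rightarrow> ennreal" where
  "hausdorff s A = (SUP \<delta> \<in> {0<..}. hausdorff_pre s \<delta> A)"

definition hausdorff_measurable :: "real \<Rightarrow> (nat \<Rightarrow> bool) set \<Rightarrow> bool" where
  "hausdorff_measurable s A \<longleftrightarrow>
     (\<forall>T. hausdorff s T = hausdorff s (T \<inter> A) + hausdorff s (T - A))"

definition hausdorff_sigma_finite :: "real \<Rightarrow> (nat \<Rightarrow> bool) set \<Rightarrow> bool" where
  "hausdorff_sigma_finite s E \<longleftrightarrow>
     (\<exists>A :: nat \<Rightarrow> (nat \<Rightarrow> bool) set. E = (\<Union>i. A i) \<and>
        (\<forall>i. hausdorff_measurable s (A i) \<and> hausdorff s (A i) < \<infinity>))"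

datatype recf = Zr | Sc | Pj nat | Cn recf "recf list" | Pr recf recf | Mn recf

inductive rec_eval :: "recf \<Rightarrow> nat list \<Rightarrow> nat \<Rightarrow> bool" where
  zero: "rec_eval Zr xs 0"
| succ: "rec_eval Sc (x # xs) (Suc x)"
| proj: "i < length xs \<Longrightarrow> rec_eval (Pj i) xs (xs ! i)"
| comp: "length ys = length gs \<Longrightarrow> (\<forall>i<length gs. rec_eval (gs ! i) xs (ys ! i))
          \<Longrightarrow> rec_eval f ys z \<Longrightarrow> rec_eval (Cn f gs) xs z"
| prim0: "rec_eval f xs y \<Longrightarrow> rec_eval (Pr f g) (0 # xs) y"
| primS: "rec_eval (Pr f g) (n # xs) y \<Longrightarrow> rec_eval g (y # n # xs) z
          \<Longrightarrow> rec_eval (Pr f g) (Suc n # xs) z"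
| mu: "rec_eval f (n # xs) 0 \<Longrightarrow> (\<forall>m<n. \<exists>k. rec_eval f (m # xs) (Suc k))
          \<Longrightarrow> rec_eval (Mn f) xs n"

definition recursive_rel2 :: "(nat \<Rightarrow> nat \<Rightarrow> bool) \<Rightarrow> bool" where
  "recursive_rel2 R \<longleftrightarrow> (\<exists>r. \<forall>a b. rec_eval r [a, b] (if R a b then 1 else 0))"

definition code_bits :: "(nat \<Rightarrow> bool) \<Rightarrow> nat \<Rightarrow> nat" where
  "code_bits x n = list_encode (map (\<lambda>i. if x i then 1 else 0) [0..<n])"

definition code_seq :: "(nat \<Rightarrow> nat) \<Rightarrow> nat \<Rightarrow> nat" where
  "code_seq f n = list_encode (map f [0..<n])"

text \<open>Lightface Sigma^1_1 subsets of Cantor space (Kleene normal form):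
  x in E iff exists f in Baire space with R(x|n, f|n) for all n, R recursive.\<close>
definition lightface_sigma11 :: "(nat \<Rightarrow> bool) set \<Rightarrow> bool" where
  "lightface_sigma11 E \<longleftrightarrow> (\<exists>R. recursive_rel2 R \<and>
     E = {x. \<exists>f :: nat \<Rightarrow> nat. \<forall>n. R (code_bits x n) (code_seq f n)})"

end

(*
Covering by cylinders, H^s on Cantor space is a net measure: it is the supremum over k of the contents
obtained from covers by cylinders of length at least k. Cylinders are nested or disjoint, which makes
each content strongly subadditive, hence continuous along increasing unions; it is also continuous along
decreasing compact sets, so it is a Choquet capacity and analytic sets are capacitable. Consequently
analytic sets of finite measure are measurable, and an analytic set of infinite measure contains
closed sets of arbitrarily large measure. If E is not sigma-finite then some x in E has
H^s (E \<inter> N) = \<infinity> for every cylinder N around x. Choosing in the n-th such cylinder a closed subset of E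
of measure at least n, and adding the limit point x, gives C.
*)
theory Submission
  imports Defs
begin

section \<open>Cylinders and their contents\<close>

definition prefix_of :: "(nat \<Rightarrow> bool) \<Rightarrow> nat \<Rightarrow> bool list" where
  "prefix_of x n = map x [0..<n]"

definition cyl :: "bool list \<Rightarrow> (nat \<Rightarrow> bool) set" where
  "cyl \<sigma> = {x. prefix_of x (length \<sigma>) = \<sigma>}"

definition cyls :: "bool list set \<Rightarrow> (nat \<Rightarrow> bool) set" where
  "cyls P = {x. \<exists>n. prefix_of x n \<in> P}"

text \<open>The \<open>s\<close>-th power of the diameter of \<open>cyl \<sigma>\<close>.\<close>

definition weight :: "real \<Rightarrow> bool list \<Rightarrow> ennreal" where
  "weight s \<sigma> = ennreal (((1/2) ^ length \<sigma>) powr s)"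

text \<open>Reading the total weight as a measure on strings gives countable subadditivity,
  additivity on disjoint sets and continuity along increasing unions at once.\<close>

definition cost :: "real \<Rightarrow> bool list set \<Rightarrow> ennreal" where
  "cost s P = emeasure (point_measure UNIV (weight s)) P"

text \<open>The lower bound \<open>k\<close> on lengths plays the role of the diameter bound
  \<open>(1/2) ^ k\<close>. Every set of strings is countable, so a set can stand in for a sequence
  of cylinders.\<close>

definition net_content :: "real \<Rightarrow> nat \<Rightarrow> (nat \<Rightarrow> bool) set \<Rightarrow> ennreal" where
  "net_content s k A = (INF P \<in> {P. (\<forall>\<sigma>\<in>P. k \<le> length \<sigma>) \<and> A \<subseteq> cyls P}. cost s P)"

lemma length_prefix_of [simp]: "length (prefix_of x n) = n"
  by (simp add: prefix_of_def)

lemma take_prefix_of: "m \<le> n \<Longrightarrow> take m (prefix_of x n) = prefix_of x m"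
  by (simp add: prefix_of_def take_map min_def)

lemma prefix_of_eq_iff: "prefix_of x n = prefix_of y n \<longleftrightarrow> (\<forall>i<n. x i = y i)"
  by (auto simp: prefix_of_def)

lemma prefix_of_eqD: "prefix_of x n = prefix_of y n \<Longrightarrow> i < n \<Longrightarrow> x i = y i"
  by (simp only: prefix_of_eq_iff)

lemma prefix_of_eq_mono: "prefix_of x n = prefix_of y n \<Longrightarrow> m \<le> n \<Longrightarrow> prefix_of x m = prefix_of y m"
  by (simp add: prefix_of_eq_iff)

lemma mem_cyl_prefix: "y \<in> cyl (prefix_of x n) \<longleftrightarrow> prefix_of y n = prefix_of x n"
  by (simp add: cyl_def)

lemma cyls_eq_UN: "cyls P = (\<Union>\<sigma>\<in>P. cyl \<sigma>)"
  unfolding cyls_def cyl_def by auto (metis)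

lemma cyls_UN: "cyls (\<Union>i\<in>I. P i) = (\<Union>i\<in>I. cyls (P i))"
  by (auto simp: cyls_def)

lemma cyls_mono: "P \<subseteq> Q \<Longrightarrow> cyls P \<subseteq> cyls Q"
  by (auto simp: cyls_def)

lemma sets_weight_measure [simp]: "sets (point_measure UNIV (weight s)) = UNIV"
  by (simp add: sets_point_measure)

lemma cost_mono: "P \<subseteq> Q \<Longrightarrow> cost s P \<le> cost s Q"
  unfolding cost_def by (rule emeasure_mono) auto

lemma cost_empty [simp]: "cost s {} = 0"
  by (simp add: cost_def)

lemma cost_singleton [simp]: "cost s {\<sigma>} = weight s \<sigma>"
  unfolding cost_def by (subst emeasure_point_measure_finite2) auto

lemma cost_UN_le: "cost s (\<Union>i. P i) \<le> (\<Sum>i::nat. cost s (P i))"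
  unfolding cost_def by (rule emeasure_subadditive_countably) auto

lemma cost_Un_disjoint: "P \<inter> Q = {} \<Longrightarrow> cost s (P \<union> Q) = cost s P + cost s Q"
  unfolding cost_def by (rule plus_emeasure[symmetric]) auto

lemma cost_Un_Int: "cost s (P \<union> Q) + cost s (P \<inter> Q) = cost s P + cost s Q"
proof -
  have "cost s (P \<union> Q) = cost s P + cost s (Q - P)"
    using cost_Un_disjoint[of P "Q - P" s] by simp
  moreover have "cost s Q = cost s (Q - P) + cost s (P \<inter> Q)"
    using cost_Un_disjoint[of "Q - P" "P \<inter> Q" s]
    by (metis Diff_disjoint Int_assoc Int_commute Un_Diff_Int Int_empty_right)
  ultimately show ?thesis by (simp add: add.assoc)
qed

text \<open>\<open>hausdorff_pre\<close> asks for covers indexed by the naturals. Here the cost of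
  \<open>P\<close> is spread over the indices \<open>to_nat \<sigma>\<close>, and every other index
  contributes 0.\<close>

lemma suminf_weight_eq_cost:
  "(\<Sum>i. if \<exists>\<sigma>\<in>P. to_nat \<sigma> = i then weight s (from_nat i) else 0) = cost s P"
proof -
  define Q where "Q i = P \<inter> {\<sigma>. to_nat \<sigma> = i}" for i
  have "disjoint_family Q"
    by (auto simp: Q_def disjoint_family_on_def)
  then have "(\<Sum>i. cost s (Q i)) = cost s (\<Union>i. Q i)"
    unfolding cost_def by (intro suminf_emeasure) auto
  moreover have "(\<Union>i. Q i) = P" by (auto simp: Q_def)
  moreover have "cost s (Q i) = (if \<exists>\<sigma>\<in>P. to_nat \<sigma> = i then weight s (from_nat i) else 0)" for i
  proof (cases "\<exists>\<sigma>\<in>P. to_nat \<sigma> = i")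
    case True
    then obtain \<sigma> where "\<sigma> \<in> P" "to_nat \<sigma> = i" by blast
    then have "Q i = {\<sigma>}" "from_nat i = \<sigma>" by (auto simp: Q_def)
    with True show ?thesis by simp
  next
    case False
    then have "Q i = {}" by (auto simp: Q_def)
    with False show ?thesis by simp
  qed
  ultimately show ?thesis by simp
qed

lemma net_content_le: "\<lbrakk>\<And>\<sigma>. \<sigma> \<in> P \<Longrightarrow> k \<le> length \<sigma>; A \<subseteq> cyls P\<rbrakk> \<Longrightarrow> net_content s k A \<le> cost s P"
  unfolding net_content_def by (intro INF_lower) auto

lemma net_content_greatest:
  "(\<And>P. \<lbrakk>\<forall>\<sigma>\<in>P. k \<le> length \<sigma>; A \<subseteq> cyls P\<rbrakk> \<Longrightarrow> c \<le> cost s P) \<Longrightarrow> c \<le> net_content s k A"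
  unfolding net_content_def by (intro INF_greatest) auto

lemma net_content_mono: "A \<subseteq> B \<Longrightarrow> net_content s k A \<le> net_content s k B"
  by (intro net_content_greatest net_content_le) auto

lemma net_content_mono_scale: "k \<le> l \<Longrightarrow> net_content s k A \<le> net_content s l A"
  by (intro net_content_greatest net_content_le) (auto intro: order_trans)

lemma net_content_empty [simp]: "net_content s k {} = 0"
  using net_content_le[of "{}" k "{}" s] by simp

lemma net_content_near_optimal:
  assumes "0 < e"
  obtains P where "\<And>\<sigma>. \<sigma> \<in> P \<Longrightarrow> k \<le> length \<sigma>" "A \<subseteq> cyls P" "cost s P \<le> net_content s k A + ennreal e"
proof (cases "net_content s k A = top")
  case True
  have "A \<subseteq> cyls {\<sigma>. k \<le> length \<sigma>}" by (auto simp: cyls_def intro!: exI[of _ k])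
  with True show ?thesis by (intro that[of "{\<sigma>. k \<le> length \<sigma>}"]) auto
next
  case False
  then have "net_content s k A < net_content s k A + ennreal e"
    using assms by (simp add: ennreal_add_left_cancel_less ennreal_less_zero_iff less_top)
  then obtain P where "\<forall>\<sigma>\<in>P. k \<le> length \<sigma>" "A \<subseteq> cyls P" "cost s P < net_content s k A + ennreal e"
    unfolding net_content_def INF_less_iff by auto
  then show ?thesis by (intro that[of P]) auto
qed

lemma suminf_ennreal_halves: "0 \<le> e \<Longrightarrow> (\<Sum>n. ennreal (e * (1/2) ^ Suc n)) = ennreal e"
  using sums_mult[OF power_half_series, of e] by (intro suminf_ennreal_eq) auto

lemma suminf_add_ennreal_halves:
  fixes f :: "nat \<Rightarrow> ennreal"
  assumes "0 \<le> e"
  shows "(\<Sum>n. f n + ennreal (e * (1/2) ^ Suc n)) = (\<Sum>n. f n) + ennreal e"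
proof -
  have "(\<Sum>n. f n) + (\<Sum>n. ennreal (e * (1/2) ^ Suc n)) = (\<Sum>n. f n + ennreal (e * (1/2) ^ Suc n))"
    by (rule suminf_add) auto
  then show ?thesis by (simp only: suminf_ennreal_halves[OF assms])
qed

text \<open>The finitely many strings of length \<open>k\<close> cover the whole space. This
  finiteness permits cancelling contents in the increasing sets lemma.\<close>

lemma net_content_finite: "net_content s k A < top"
proof -
  have "net_content s k A \<le> cost s {\<sigma>. length \<sigma> = k}"
    by (intro net_content_le) (auto simp: cyls_def)
  also have "finite {\<sigma> :: bool list. length \<sigma> = k}"
    using finite_lists_length_eq[of "UNIV :: bool set" k] by simp
  then have "cost s {\<sigma>. length \<sigma> = k} < top"
    unfolding cost_def by (subst emeasure_point_measure_finite2) (auto simp: weight_def ennreal_mult_less_top of_nat_less_top)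
  finally show ?thesis .
qed

lemma net_content_UN_le: "net_content s k (\<Union>i. A i) \<le> (\<Sum>i::nat. net_content s k (A i))"
proof (rule ennreal_le_epsilon)
  fix e :: real assume e: "0 < e"
  have "\<exists>P. (\<forall>\<sigma>\<in>P. k \<le> length \<sigma>) \<and> A i \<subseteq> cyls P \<and>
      cost s P \<le> net_content s k (A i) + ennreal (e * (1/2) ^ Suc i)" for i
    using net_content_near_optimal[of "e * (1/2) ^ Suc i" k "A i" s] e by (metis mult_pos_pos half_gt_zero_iff zero_less_one zero_less_power)
  then obtain P where P: "\<And>i \<sigma>. \<sigma> \<in> P i \<Longrightarrow> k \<le> length \<sigma>" "\<And>i. A i \<subseteq> cyls (P i)"
      "\<And>i. cost s (P i) \<le> net_content s k (A i) + ennreal (e * (1/2) ^ Suc i)"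
    by metis
  have "net_content s k (\<Union>i. A i) \<le> cost s (\<Union>i. P i)"
    using P(1,2) by (intro net_content_le) (auto simp: cyls_UN, blast)
  also have "\<dots> \<le> (\<Sum>i. cost s (P i))" by (rule cost_UN_le)
  also have "\<dots> \<le> (\<Sum>i. net_content s k (A i) + ennreal (e * (1/2) ^ Suc i))"
    by (intro suminf_le P(3)) auto
  also have "\<dots> = (\<Sum>i. net_content s k (A i)) + ennreal e"
    using e by (intro suminf_add_ennreal_halves) simp
  finally show "net_content s k (\<Union>i. A i) \<le> (\<Sum>i. net_content s k (A i)) + ennreal e" .
qed

section \<open>The increasing sets lemma\<close>

text \<open>Prefix-minimal strings correspond to the maximal cylinders, which are pairwise
  disjoint.\<close>

definition minimal_strings :: "bool list set \<Rightarrow> bool list set" where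
  "minimal_strings P = {\<sigma>\<in>P. \<forall>m<length \<sigma>. take m \<sigma> \<notin> P}"

lemma minimal_strings_subset: "minimal_strings P \<subseteq> P"
  by (auto simp: minimal_strings_def)

lemma cyls_minimal_strings: "cyls (minimal_strings P) = cyls P"
proof (intro antisym subsetI)
  fix x assume "x \<in> cyls P"
  then obtain n where n: "prefix_of x n \<in> P" by (auto simp: cyls_def)
  define m where "m = (LEAST m. prefix_of x m \<in> P)"
  have "prefix_of x m \<in> P" unfolding m_def by (rule LeastI[of _ n]) (rule n)
  moreover have "prefix_of x i \<notin> P" if "i < m" for i
    using that not_less_Least unfolding m_def by blast
  ultimately have "prefix_of x m \<in> minimal_strings P"
    by (auto simp: minimal_strings_def take_prefix_of)
  then show "x \<in> cyls (minimal_strings P)" by (auto simp: cyls_def)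
qed (use cyls_mono[OF minimal_strings_subset] in auto)

text \<open>Two cylinders are nested or disjoint, so the strings that are not minimal in
  \<open>P \<union> Q\<close>, together with the common ones, still cover \<open>cyls P \<inter> cyls Q\<close>.\<close>
lemma cost_minimal_strings_Un:
  assumes "\<And>\<sigma>. \<sigma> \<in> P \<union> Q \<Longrightarrow> k \<le> length \<sigma>"
  shows "cost s (minimal_strings (P \<union> Q)) + net_content s k (cyls P \<inter> cyls Q) \<le> cost s P + cost s Q"
proof -
  define M where "M = minimal_strings (P \<union> Q)"
  define R where "R = (P \<union> Q - M) \<union> (P \<inter> Q)"
  have M: "M \<subseteq> P \<union> Q" unfolding M_def by (rule minimal_strings_subset)
  have later: "prefix_of x n \<in> R" if "prefix_of x m \<in> P \<union> Q" "prefix_of x n \<in> P \<union> Q" "m < n" for x m n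
  proof -
    have "take m (prefix_of x n) \<in> P \<union> Q" using that by (simp add: take_prefix_of)
    with \<open>m < n\<close> have "prefix_of x n \<notin> M" unfolding M_def minimal_strings_def by auto
    with that show ?thesis by (auto simp: R_def)
  qed
  have "cyls P \<inter> cyls Q \<subseteq> cyls R"
  proof
    fix x assume "x \<in> cyls P \<inter> cyls Q"
    then obtain m n where mn: "prefix_of x m \<in> P" "prefix_of x n \<in> Q" by (auto simp: cyls_def)
    consider "m < n" | "n < m" | "m = n" by linarith
    then show "x \<in> cyls R"
    proof cases
      case 3
      with mn show ?thesis by (auto simp: cyls_def R_def)
    qed (use mn later[of x m n] later[of x n m] in \<open>auto simp: cyls_def\<close>)
  qed
  then have "net_content s k (cyls P \<inter> cyls Q) \<le> cost s R"
    using assms by (intro net_content_le) (auto simp: R_def)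
  \<comment> \<open>The two pieces of \<open>R\<close> may overlap, hence subadditivity. The common
    strings are affordable because \<open>cost s P + cost s Q\<close> counts them twice.\<close>
  also have "\<dots> \<le> cost s (P \<union> Q - M) + cost s (P \<inter> Q)"
    unfolding R_def cost_def by (rule emeasure_subadditive) auto
  finally have "cost s M + net_content s k (cyls P \<inter> cyls Q) \<le> cost s M + (cost s (P \<union> Q - M) + cost s (P \<inter> Q))"
    by (rule add_left_mono)
  also have "\<dots> = cost s (P \<union> Q) + cost s (P \<inter> Q)"
    using cost_Un_disjoint[of M "P \<union> Q - M" s] M by (simp add: add.assoc[symmetric] Un_absorb1)
  also have "\<dots> = cost s P + cost s Q" by (rule cost_Un_Int)
  finally show ?thesis unfolding M_def .
qed

text \<open>Near-optimal covers of the \<open>A n\<close> are merged one at a time and pruned to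
  minimal strings. Strong subadditivity keeps the cost of each merged cover within the accumulated
  errors of the content of \<open>A n\<close>, and all errors together sum to
  \<open>e\<close>.\<close>

lemma net_content_UN_incseq_le:
  assumes inc: "incseq A" and L: "\<And>n. net_content s k (A n) \<le> L"
  shows "net_content s k (\<Union>n. A n) \<le> L"
proof (rule ennreal_le_epsilon)
  fix e :: real assume e: "0 < e"
  define d where "d i = ennreal (e * (1/2) ^ Suc i)" for i :: nat
  have "\<exists>P. (\<forall>\<sigma>\<in>P. k \<le> length \<sigma>) \<and> A i \<subseteq> cyls P \<and> cost s P \<le> net_content s k (A i) + d i" for i
    using net_content_near_optimal[of "e * (1/2) ^ Suc i" k "A i" s] e unfolding d_def
    by (metis mult_pos_pos half_gt_zero_iff zero_less_one zero_less_power)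
  then obtain P where P: "\<And>i \<sigma>. \<sigma> \<in> P i \<Longrightarrow> k \<le> length \<sigma>" "\<And>i. A i \<subseteq> cyls (P i)"
      "\<And>i. cost s (P i) \<le> net_content s k (A i) + d i"
    by metis
  define M where "M = rec_nat (P 0) (\<lambda>i Q. minimal_strings (Q \<union> P (Suc i)))"
  have M0: "M 0 = P 0" and MS: "M (Suc i) = minimal_strings (M i \<union> P (Suc i))" for i
    by (simp_all add: M_def)
  have M_sub: "M n \<subseteq> (\<Union>i\<le>n. P i)" for n
  proof (induction n)
    case (Suc n)
    then show ?case using minimal_strings_subset[of "M n \<union> P (Suc n)"]
      by (auto simp: MS atMost_Suc)
  qed (simp add: M0)
  have M_len: "k \<le> length \<sigma>" if "\<sigma> \<in> M n" for \<sigma> n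
    using that M_sub[of n] P(1) by blast
  have M_cov: "A n \<subseteq> cyls (M n)" for n
  proof (cases n)
    case (Suc i)
    then show ?thesis
      using P(2)[of n] cyls_mono[of "P n" "M i \<union> P n"] by (auto simp: MS cyls_minimal_strings)
  qed (use P(2) M0 in auto)
  have M_cost: "cost s (M n) \<le> net_content s k (A n) + (\<Sum>i\<le>n. d i)" for n
  proof (induction n)
    case 0
    show ?case using P(3)[of 0] by (simp add: M0)
  next
    case (Suc n)
    \<comment> \<open>Both covers being merged contain \<open>A n\<close>, so the content of their
      overlap is at least that of \<open>A n\<close>. This finite amount is cancelled at the
      end.\<close>
    have "A n \<subseteq> cyls (M n) \<inter> cyls (P (Suc n))"
      using M_cov[of n] P(2)[of "Suc n"] incseq_SucD[OF inc, of n] by blast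
    then have "cost s (M (Suc n)) + net_content s k (A n)
        \<le> cost s (M (Suc n)) + net_content s k (cyls (M n) \<inter> cyls (P (Suc n)))"
      by (intro add_left_mono net_content_mono)
    also have "\<dots> \<le> cost s (M n) + cost s (P (Suc n))"
      unfolding MS using M_len P(1) by (intro cost_minimal_strings_Un) auto
    also have "\<dots> \<le> (net_content s k (A n) + (\<Sum>i\<le>n. d i)) + (net_content s k (A (Suc n)) + d (Suc n))"
      by (intro add_mono Suc P(3))
    also have "\<dots> = (net_content s k (A (Suc n)) + (\<Sum>i\<le>Suc n. d i)) + net_content s k (A n)"
      by (simp add: ac_simps)
    finally show ?case
      using net_content_finite[of s k "A n"]
      unfolding add.commute[of _ "net_content s k (A n)"] ennreal_add_left_cancel_le by auto
  qed
  \<comment> \<open>The covers \<open>M n\<close> need not increase, so the limit cover is taken to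
    be the minimal strings of the union of all \<open>P i\<close>. Such a string, once it occurs in
    \<open>P i\<close>, survives every pruning and lies in each \<open>M n\<close> with
    \<open>i \<le> n\<close>.\<close>
  define N where "N = minimal_strings (\<Union>i. P i)"
  define N' where "N' n = N \<inter> (\<Union>i\<le>n. P i)" for n
  have "N' n \<subseteq> M n" for n
  proof (induction n)
    case 0
    then show ?case by (auto simp: N'_def M0)
  next
    case (Suc n)
    show ?case
    proof
      fix \<sigma> assume \<sigma>: "\<sigma> \<in> N' (Suc n)"
      then have "\<sigma> \<in> M n \<union> P (Suc n)" using Suc by (auto simp: N'_def atMost_Suc)
      moreover have "take m \<sigma> \<notin> M n \<union> P (Suc n)" if "m < length \<sigma>" for m
        using \<sigma> that M_sub[of n] unfolding N'_def N_def minimal_strings_def by blast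
      ultimately show "\<sigma> \<in> M (Suc n)" unfolding MS minimal_strings_def by auto
    qed
  qed
  then have N'_le: "cost s (N' n) \<le> L + ennreal e" for n
  proof -
    have "(\<Sum>i\<le>n. d i) \<le> (\<Sum>i. d i)"
      by (intro sum_le_suminf) auto
    also have "\<dots> = ennreal e" unfolding d_def using e by (simp only: suminf_ennreal_halves less_imp_le)
    finally have "net_content s k (A n) + (\<Sum>i\<le>n. d i) \<le> L + ennreal e" by (intro add_mono L)
    with M_cost[of n] cost_mono[OF \<open>N' n \<subseteq> M n\<close>, of s] show ?thesis by (meson order_trans)
  qed
  have "(\<Union>n. A n) \<subseteq> cyls (\<Union>i. P i)" using P(2) by (auto simp: cyls_UN)
  then have "net_content s k (\<Union>n. A n) \<le> cost s N"
    unfolding N_def using P(1) minimal_strings_subset[of "\<Union>i. P i"]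
    by (intro net_content_le) (auto simp: cyls_minimal_strings)
  also have "\<dots> = cost s (\<Union>n. N' n)"
    using minimal_strings_subset[of "\<Union>i. P i"] unfolding N_def N'_def by (intro arg_cong[of _ _ "cost s"]) blast
  also have "\<dots> = (SUP n. cost s (N' n))"
    unfolding cost_def by (rule SUP_emeasure_incseq[symmetric]) (auto simp: incseq_def N'_def, meson atMost_iff order_trans)
  also have "\<dots> \<le> L + ennreal e" by (intro SUP_least N'_le)
  finally show "net_content s k (\<Union>n. A n) \<le> L + ennreal e" .
qed

section \<open>Hausdorff measure as a net measure\<close>

lemma cantor_dist_le: "prefix_of x n = prefix_of y n \<Longrightarrow> cantor_dist x y \<le> (1/2) ^ n"
proof (cases "x = y")
  case False
  assume eq: "prefix_of x n = prefix_of y n"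
  from False obtain m where "x m \<noteq> y m" by blast
  then have "x (LEAST m. x m \<noteq> y m) \<noteq> y (LEAST m. x m \<noteq> y m)" by (rule LeastI)
  then have "n \<le> (LEAST m. x m \<noteq> y m)"
    using prefix_of_eqD[OF eq] by (intro leI) blast
  with False show ?thesis by (simp add: cantor_dist_def power_decreasing)
qed (simp add: cantor_dist_def)

lemma cantor_dist_less_imp_prefix_eq:
  assumes "cantor_dist x y < (1/2) ^ n"
  shows "prefix_of x n = prefix_of y n"
proof (rule ccontr)
  assume "prefix_of x n \<noteq> prefix_of y n"
  then obtain i where i: "i < n" "x i \<noteq> y i" by (auto simp: prefix_of_eq_iff)
  from i(2) have "(LEAST m. x m \<noteq> y m) \<le> i" by (rule Least_le)
  with i(1) have "(LEAST m. x m \<noteq> y m) \<le> n" by simp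
  then have "(1/2 :: real) ^ n \<le> (1/2) ^ (LEAST m. x m \<noteq> y m)" by (intro power_decreasing) auto
  with assms i show False by (auto simp: cantor_dist_def split: if_splits)
qed

lemma cantor_dist_nonneg: "0 \<le> cantor_dist x y"
  by (simp add: cantor_dist_def)

lemma cantor_dist_le_1: "cantor_dist x y \<le> 1"
  using cantor_dist_le[of x 0 y] by (simp add: prefix_of_def)

text \<open>Distance below \<open>(1/2) ^ n\<close> forces the first \<open>n\<close> values to
  agree, and such agreement bounds the distance by \<open>(1/2) ^ n\<close>. Closeness can therefore
  be tested on prefixes.\<close>

lemma cantor_closed_iff:
  "cantor_closed C \<longleftrightarrow> (\<forall>x. (\<forall>n. \<exists>y\<in>C. prefix_of y n = prefix_of x n) \<longrightarrow> x \<in> C)"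
proof -
  have "(\<forall>e>0. \<exists>y\<in>C. cantor_dist x y < e) \<longleftrightarrow> (\<forall>n. \<exists>y\<in>C. prefix_of y n = prefix_of x n)" for x
  proof (intro iffI allI impI)
    fix n assume "\<forall>e>0. \<exists>y\<in>C. cantor_dist x y < e"
    then obtain y where "y \<in> C" "cantor_dist x y < (1/2) ^ n" by (meson half_gt_zero_iff zero_less_one zero_less_power)
    then show "\<exists>y\<in>C. prefix_of y n = prefix_of x n" by (metis cantor_dist_less_imp_prefix_eq)
  next
    fix e :: real assume pr: "\<forall>n. \<exists>y\<in>C. prefix_of y n = prefix_of x n" and "0 < e"
    then obtain n where "(1/2) ^ n < e" using real_arch_pow_inv[of e "1/2"] by auto
    moreover obtain y where "y \<in> C" "prefix_of y n = prefix_of x n" using pr by blast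
    ultimately show "\<exists>y\<in>C. cantor_dist x y < e" by (metis cantor_dist_le order_le_less_trans)
  qed
  then show ?thesis by (simp add: cantor_closed_def)
qed

lemma cantor_closed_separated:
  "cantor_closed C \<Longrightarrow> x \<notin> C \<Longrightarrow> \<exists>n. \<forall>y\<in>C. prefix_of y n \<noteq> prefix_of x n"
  unfolding cantor_closed_iff by (drule spec[of _ x]) auto

lemma cantor_diam_upper: "x \<in> U \<Longrightarrow> y \<in> U \<Longrightarrow> cantor_dist x y \<le> cantor_diam U"
  unfolding cantor_diam_def
  by (auto intro!: cSup_upper bdd_aboveI[of _ 1] simp: cantor_dist_le_1)

lemma cantor_diam_nonneg: "0 \<le> cantor_diam U"
proof (cases "U = {}")
  case False
  then obtain x where "x \<in> U" by blast
  then show ?thesis using cantor_diam_upper[of x U x] cantor_dist_nonneg[of x x] by simp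
qed (simp add: cantor_diam_def)

lemma cantor_diam_cyl_le: "cantor_diam (cyl \<sigma>) \<le> (1/2) ^ length \<sigma>"
  unfolding cantor_diam_def by (auto simp: cyl_def intro!: cSup_least cantor_dist_le)

text \<open>Since \<open>s\<close> is positive, every point has arbitrarily cheap cylinders around
  it; they pay for sets of diameter 0.\<close>

lemma weight_tendsto_zero:
  assumes "0 < s" "0 < e"
  obtains n where "k \<le> n" "((1/2) ^ n) powr s \<le> (e :: real)"
proof -
  have "(1/2 :: real) powr s < 1" using assms powr_less_mono2[of s "1/2" 1] by simp
  then obtain m where m: "((1/2) powr s) ^ m < e" using real_arch_pow_inv[of e "(1/2) powr s"] assms by auto
  have "((1/2) ^ n) powr s = ((1/2) powr s) ^ n" for n :: nat
    by (induction n) (simp_all only: power_Suc power_0 powr_mult powr_one_eq_one)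
  then have "((1/2) ^ max k m) powr s = ((1/2) powr s) ^ max k m" .
  also have "\<dots> \<le> ((1/2) powr s) ^ m" using \<open>(1/2) powr s < 1\<close> by (intro power_decreasing) auto
  finally show ?thesis using m by (intro that[of "max k m"]) auto
qed

text \<open>A set of diameter \<open>2 ^ - n\<close> lies in a cylinder of the same diameter; the error \<open>e\<close> is
  needed for sets with at most one point, which have diameter 0.\<close>
lemma cyl_cover:
  assumes s: "0 < s" and e: "0 < e" and diam: "cantor_diam U \<le> (1/2) ^ k"
  obtains \<sigma> where "k \<le> length \<sigma>" "U \<subseteq> cyl \<sigma>" "weight s \<sigma> \<le> ennreal (cantor_diam U powr s) + ennreal e"
proof (cases "\<exists>n. \<exists>x\<in>U. \<exists>y\<in>U. x n \<noteq> y n")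
  case False
  then have "x = y" if "x \<in> U" "y \<in> U" for x y
    using that by (intro ext) blast
  then obtain x where "U \<subseteq> {x}" by (cases "U = {}") auto
  obtain n where n: "k \<le> n" "((1/2) ^ n) powr s \<le> e" using weight_tendsto_zero[OF s e] .
  show ?thesis
  proof (rule that[of "prefix_of x n"])
    show "weight s (prefix_of x n) \<le> ennreal (cantor_diam U powr s) + ennreal e"
      using n e by (auto simp: weight_def intro!: add_increasing simp flip: ennreal_plus)
  qed (use n \<open>U \<subseteq> {x}\<close> in \<open>auto simp: mem_cyl_prefix\<close>)
next
  case True
  \<comment> \<open>At the first place \<open>n\<close> where two members of \<open>U\<close>
    differ, all of \<open>U\<close> still shares a prefix of length \<open>n\<close>, while these
    two members make the diameter at least \<open>(1/2) ^ n\<close>.\<close>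
  define n where "n = (LEAST n. \<exists>x\<in>U. \<exists>y\<in>U. x n \<noteq> y n)"
  have "\<exists>x\<in>U. \<exists>y\<in>U. x n \<noteq> y n" unfolding n_def by (rule LeastI_ex[OF True])
  then obtain x y where xy: "x \<in> U" "y \<in> U" "x n \<noteq> y n" by blast
  have agree: "x' i = y' i" if "x' \<in> U" "y' \<in> U" "i < n" for x' y' i
  proof -
    have "\<not> (\<exists>x\<in>U. \<exists>y\<in>U. x i \<noteq> y i)" using that(3) unfolding n_def by (rule not_less_Least)
    with that(1,2) show ?thesis by blast
  qed
  have "(LEAST n. x n \<noteq> y n) = n"
    using xy(3) agree[OF xy(1,2)] by (intro Least_equality leI) blast+
  then have "cantor_dist x y = (1/2) ^ n" using xy by (auto simp: cantor_dist_def)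
  then have n_le: "(1/2) ^ n \<le> cantor_diam U" using cantor_diam_upper[OF xy(1,2)] by simp
  have "k \<le> n" using order_trans[OF n_le diam] by simp
  show ?thesis
  proof (rule that[of "prefix_of x n"])
    have "((1/2) ^ n) powr s \<le> cantor_diam U powr s" using n_le s by (intro powr_mono2) auto
    then show "weight s (prefix_of x n) \<le> ennreal (cantor_diam U powr s) + ennreal e"
      using e by (simp add: weight_def flip: ennreal_plus)
    show "U \<subseteq> cyl (prefix_of x n)" using agree xy(1) by (auto simp: mem_cyl_prefix prefix_of_eq_iff)
  qed (use \<open>k \<le> n\<close> in auto)
qed

lemma hausdorff_pre_le_net_content:
  assumes s: "0 < s" and k: "(1/2) ^ k \<le> \<delta>"
  shows "hausdorff_pre s \<delta> A \<le> net_content s k A"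
proof (rule net_content_greatest)
  fix P assume P: "\<forall>\<sigma>\<in>P. k \<le> length \<sigma>" "A \<subseteq> cyls P"
  \<comment> \<open>Indices that code no string of \<open>P\<close> receive the empty set, whose
    diameter is 0 by definition and whose term is \<open>0 powr s = 0\<close>.\<close>
  define U where "U i = (if \<exists>\<sigma>\<in>P. to_nat \<sigma> = i then cyl (from_nat i) else {})" for i :: nat
  have "A \<subseteq> (\<Union>i. U i)"
  proof
    fix x assume "x \<in> A"
    then obtain \<sigma> where "\<sigma> \<in> P" "x \<in> cyl \<sigma>" using P(2) by (auto simp: cyls_eq_UN)
    then have "x \<in> U (to_nat \<sigma>)" by (auto simp: U_def)
    then show "x \<in> (\<Union>i. U i)" by blast
  qed
  moreover have "cantor_diam (U i) \<le> \<delta>" for i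
  proof (cases "\<exists>\<sigma>\<in>P. to_nat \<sigma> = i")
    case True
    then obtain \<sigma> where \<sigma>: "\<sigma> \<in> P" "to_nat \<sigma> = i" by blast
    then have "cantor_diam (U i) \<le> (1/2) ^ length \<sigma>"
      using cantor_diam_cyl_le[of \<sigma>] by (auto simp: U_def)
    also have "\<dots> \<le> (1/2) ^ k" using P \<sigma> by (intro power_decreasing) auto
    finally show ?thesis using k by simp
  next
    case False
    have "0 \<le> (1/2 :: real) ^ k" by simp
    with k have "0 \<le> \<delta>" by linarith
    with False show ?thesis by (simp add: U_def cantor_diam_def)
  qed
  ultimately have "hausdorff_pre s \<delta> A \<le> (\<Sum>i. ennreal (cantor_diam (U i) powr s))"
    unfolding hausdorff_pre_def by (intro INF_lower) auto
  also have "\<dots> \<le> (\<Sum>i. if \<exists>\<sigma>\<in>P. to_nat \<sigma> = i then weight s (from_nat i) else 0)"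
  proof (intro suminf_le)
    fix i
    show "ennreal (cantor_diam (U i) powr s) \<le> (if \<exists>\<sigma>\<in>P. to_nat \<sigma> = i then weight s (from_nat i) else 0)"
      using s by (auto simp: U_def weight_def cantor_diam_def[of "{}"]
          intro!: ennreal_leI powr_mono2 cantor_diam_nonneg cantor_diam_cyl_le)
  qed auto
  also have "\<dots> = cost s P" by (rule suminf_weight_eq_cost)
  finally show "hausdorff_pre s \<delta> A \<le> cost s P" .
qed

lemma net_content_le_hausdorff_pre:
  assumes s: "0 < s"
  shows "net_content s k A \<le> hausdorff_pre s ((1/2) ^ k) A"
  unfolding hausdorff_pre_def
proof (rule INF_greatest, clarify)
  fix U :: "nat \<Rightarrow> (nat \<Rightarrow> bool) set"
  assume U: "A \<subseteq> (\<Union>i. U i)" "\<forall>i. cantor_diam (U i) \<le> (1/2) ^ k"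
  show "net_content s k A \<le> (\<Sum>i. ennreal (cantor_diam (U i) powr s))"
  proof (rule ennreal_le_epsilon)
    fix e :: real assume e: "0 < e"
    have "\<exists>\<sigma>. k \<le> length \<sigma> \<and> U i \<subseteq> cyl \<sigma> \<and>
        weight s \<sigma> \<le> ennreal (cantor_diam (U i) powr s) + ennreal (e * (1/2) ^ Suc i)" for i
    proof -
      have "0 < e * (1/2) ^ Suc i" using e by simp
      from cyl_cover[OF s this U(2)[rule_format, of i]] show ?thesis by metis
    qed
    then obtain \<sigma> where \<sigma>: "\<And>i. k \<le> length (\<sigma> i)" "\<And>i. U i \<subseteq> cyl (\<sigma> i)"
      "\<And>i. weight s (\<sigma> i) \<le> ennreal (cantor_diam (U i) powr s) + ennreal (e * (1/2) ^ Suc i)"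
      by metis
    have cover: "A \<subseteq> cyls (\<Union>i. {\<sigma> i})"
      using \<sigma>(2) U(1) unfolding cyls_eq_UN by fastforce
    have "net_content s k A \<le> cost s (\<Union>i. {\<sigma> i})"
      using \<sigma>(1) by (intro net_content_le cover) auto
    \<comment> \<open>Distinct indices may yield the same string, which only lowers the
      cost.\<close>
    also have "\<dots> \<le> (\<Sum>i. cost s {\<sigma> i})" by (rule cost_UN_le)
    also have "\<dots> \<le> (\<Sum>i. ennreal (cantor_diam (U i) powr s) + ennreal (e * (1/2) ^ Suc i))"
      using \<sigma>(3) by (intro suminf_le) auto
    also have "\<dots> = (\<Sum>i. ennreal (cantor_diam (U i) powr s)) + ennreal e"
      using e by (intro suminf_add_ennreal_halves) simp
    finally show "net_content s k A \<le> (\<Sum>i. ennreal (cantor_diam (U i) powr s)) + ennreal e" .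
  qed
qed

text \<open>Below every positive \<open>\<delta>\<close> there is some \<open>(1/2) ^ k\<close>, and
  each \<open>(1/2) ^ k\<close> is itself an admissible \<open>\<delta>\<close>, so the two
  comparisons above identify the suprema.\<close>

lemma hausdorff_eq_SUP_net_content:
  assumes s: "0 < s"
  shows "hausdorff s A = (SUP k. net_content s k A)"
proof (rule antisym)
  show "hausdorff s A \<le> (SUP k. net_content s k A)"
    unfolding hausdorff_def
  proof (rule SUP_least)
    fix \<delta> :: real assume "\<delta> \<in> {0<..}"
    then obtain k where "(1/2) ^ k < \<delta>" using real_arch_pow_inv[of \<delta> "1/2"] by auto
    then have "hausdorff_pre s \<delta> A \<le> net_content s k A"
      by (intro hausdorff_pre_le_net_content s) auto
    then show "hausdorff_pre s \<delta> A \<le> (SUP k. net_content s k A)" by (rule SUP_upper2[rotated]) auto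
  qed
  show "(SUP k. net_content s k A) \<le> hausdorff s A"
    unfolding hausdorff_def
    by (intro SUP_least order_trans[OF net_content_le_hausdorff_pre[OF s]] SUP_upper) auto
qed

lemma net_content_le_hausdorff: "0 < s \<Longrightarrow> net_content s k A \<le> hausdorff s A"
  unfolding hausdorff_eq_SUP_net_content by (rule SUP_upper) simp

lemma hausdorff_mono: "0 < s \<Longrightarrow> A \<subseteq> B \<Longrightarrow> hausdorff s A \<le> hausdorff s B"
  unfolding hausdorff_eq_SUP_net_content by (intro SUP_mono' net_content_mono)

lemma hausdorff_empty: "0 < s \<Longrightarrow> hausdorff s {} = 0"
  by (simp add: hausdorff_eq_SUP_net_content)

lemma hausdorff_UN_le:
  assumes "0 < s"
  shows "hausdorff s (\<Union>i. A i) \<le> (\<Sum>i::nat. hausdorff s (A i))"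
  unfolding hausdorff_eq_SUP_net_content[OF assms, of "\<Union>i. A i"]
proof (rule SUP_least)
  fix k
  have "net_content s k (\<Union>i. A i) \<le> (\<Sum>i. net_content s k (A i))" by (rule net_content_UN_le)
  also have "\<dots> \<le> (\<Sum>i. hausdorff s (A i))"
    using assms by (intro suminf_le net_content_le_hausdorff) auto
  finally show "net_content s k (\<Union>i. A i) \<le> (\<Sum>i. hausdorff s (A i))" .
qed

section \<open>Measurability\<close>

lemma outer_measure_space_hausdorff:
  "0 < s \<Longrightarrow> outer_measure_space UNIV (hausdorff s)"
  unfolding outer_measure_space_def positive_def increasing_def countably_subadditive_def
  by (intro conjI allI ballI impI hausdorff_empty hausdorff_UN_le hausdorff_mono)

lemma hausdorff_Int_Diff_ge:
  assumes "0 < s"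
  shows "hausdorff s T \<le> hausdorff s (T \<inter> A) + hausdorff s (T - A)"
proof -
  have "hausdorff s T \<le> hausdorff s (\<Union>i. binaryset (T \<inter> A) (T - A) i)"
    by (intro hausdorff_mono assms) (auto simp: UN_binaryset_eq)
  also have "\<dots> \<le> (\<Sum>i. hausdorff s (binaryset (T \<inter> A) (T - A) i))"
    by (rule hausdorff_UN_le[OF assms])
  also have "\<dots> = hausdorff s (T \<inter> A) + hausdorff s (T - A)"
    by (rule suminf_binaryset_eq) (rule hausdorff_empty[OF assms])
  finally show ?thesis .
qed

lemma hausdorff_measurable_iff_lambda_system:
  "hausdorff_measurable s A \<longleftrightarrow> A \<in> lambda_system UNIV UNIV (hausdorff s)"
  unfolding hausdorff_measurable_def lambda_system_def
  by (simp add: Int_commute Diff_eq Compl_eq_Diff_UNIV[symmetric] eq_commute)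

text \<open>Caratheodory's theorem for the outer measure \<open>hausdorff s\<close>, whose lambda
  system is the class of measurable sets.\<close>

lemma sigma_algebra_hausdorff_measurable:
  assumes "0 < s"
  shows "sigma_algebra UNIV {A. hausdorff_measurable s A}"
proof -
  have "sigma_algebra UNIV (UNIV :: (nat \<Rightarrow> bool) set set)"
    using sigma_algebra_Pow[of UNIV] by simp
  from sigma_algebra.caratheodory_lemma[OF this outer_measure_space_hausdorff[OF assms]]
  show ?thesis
    by (simp add: measure_space_def hausdorff_measurable_iff_lambda_system)
qed

text \<open>A cylinder of length at least \<open>length \<sigma>\<close> lies inside
  \<open>cyl \<sigma>\<close> or misses it. Every sufficiently fine cover of \<open>T\<close> thus
  splits into a cover of the part inside and a cover of the part outside.\<close>

lemma hausdorff_measurable_cyl: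
  assumes s: "0 < s"
  shows "hausdorff_measurable s (cyl \<sigma>)"
  unfolding hausdorff_measurable_def
proof (intro allI antisym hausdorff_Int_Diff_ge s)
  fix T
  define N where "N = cyl \<sigma>"
  have split: "net_content s k (T \<inter> N) + net_content s k (T - N) \<le> net_content s k T"
    if k: "length \<sigma> \<le> k" for k
  proof (rule net_content_greatest)
    fix P assume P: "\<forall>\<tau>\<in>P. k \<le> length \<tau>" "T \<subseteq> cyls P"
    define Q where "Q = {\<tau>\<in>P. take (length \<sigma>) \<tau> = \<sigma>}"
    have in_Q: "prefix_of x n \<in> Q \<longleftrightarrow> x \<in> N" if "prefix_of x n \<in> P" for x n
    proof -
      have "length \<sigma> \<le> n" using P(1) that k by fastforce
      then show ?thesis using that by (simp add: Q_def N_def cyl_def take_prefix_of)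
    qed
    have "T \<inter> N \<subseteq> cyls Q" "T - N \<subseteq> cyls (P - Q)"
      using P(2) in_Q unfolding cyls_def by blast+
    then have "net_content s k (T \<inter> N) + net_content s k (T - N) \<le> cost s Q + cost s (P - Q)"
      using P(1) by (intro add_mono net_content_le) (auto simp: Q_def)
    also have "\<dots> = cost s P"
      by (subst cost_Un_disjoint[symmetric]) (auto simp: Q_def intro!: arg_cong[of _ _ "cost s"])
    finally show "net_content s k (T \<inter> N) + net_content s k (T - N) \<le> cost s P" .
  qed
  \<comment> \<open>Both contents increase with \<open>k\<close>, so the suprema may be added scale
    by scale.\<close>
  have "hausdorff s (T \<inter> N) + hausdorff s (T - N) = (SUP k. net_content s k (T \<inter> N) + net_content s k (T - N))"
    by (subst ennreal_SUP_add)
      (auto simp: incseq_def net_content_mono_scale hausdorff_eq_SUP_net_content[OF s])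
  also have "\<dots> \<le> hausdorff s T"
  proof (rule SUP_least)
    fix k
    define l where "l = max k (length \<sigma>)"
    have "net_content s k (T \<inter> N) + net_content s k (T - N) \<le> net_content s l (T \<inter> N) + net_content s l (T - N)"
      by (intro add_mono net_content_mono_scale) (auto simp: l_def)
    also have "\<dots> \<le> net_content s l T" by (rule split) (simp add: l_def)
    also have "\<dots> \<le> hausdorff s T" by (rule net_content_le_hausdorff[OF s])
    finally show "net_content s k (T \<inter> N) + net_content s k (T - N) \<le> hausdorff s T" .
  qed
  finally show "hausdorff s (T \<inter> cyl \<sigma>) + hausdorff s (T - cyl \<sigma>) \<le> hausdorff s T"
    by (simp add: N_def)
qed

text \<open>The complement is a union of cylinders, and there are only countably many
  cylinders.\<close>

lemma hausdorff_measurable_closed: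
  assumes s: "0 < s" and C: "cantor_closed C"
  shows "hausdorff_measurable s C"
proof -
  interpret sigma_algebra UNIV "{A. hausdorff_measurable s A}"
    by (rule sigma_algebra_hausdorff_measurable[OF s])
  have "x \<in> (\<Union>\<sigma>\<in>{\<sigma>. cyl \<sigma> \<inter> C = {}}. cyl \<sigma>)" if notin: "x \<notin> C" for x
  proof -
    obtain n where "\<forall>y\<in>C. prefix_of y n \<noteq> prefix_of x n"
      using cantor_closed_separated[OF C notin] by blast
    then have "cyl (prefix_of x n) \<inter> C = {}" by (auto simp: mem_cyl_prefix)
    moreover have "x \<in> cyl (prefix_of x n)" by (simp add: mem_cyl_prefix)
    ultimately show ?thesis by blast
  qed
  then have "C = UNIV - (\<Union>\<sigma>\<in>{\<sigma>. cyl \<sigma> \<inter> C = {}}. cyl \<sigma>)" by auto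
  moreover have "(\<Union>\<sigma>\<in>{\<sigma>. cyl \<sigma> \<inter> C = {}}. cyl \<sigma>) \<in> {A. hausdorff_measurable s A}"
    by (rule countable_UN'') (auto simp: hausdorff_measurable_cyl[OF s])
  ultimately show ?thesis using compl_sets by (metis mem_Collect_eq)
qed

lemma hausdorff_measurable_null:
  assumes s: "0 < s" and null: "hausdorff s A = 0"
  shows "hausdorff_measurable s A"
  unfolding hausdorff_measurable_def
proof (intro allI antisym hausdorff_Int_Diff_ge s)
  fix T
  have "hausdorff s (T \<inter> A) = 0" using hausdorff_mono[OF s, of "T \<inter> A" A] null by simp
  then show "hausdorff s (T \<inter> A) + hausdorff s (T - A) \<le> hausdorff s T"
    using hausdorff_mono[OF s, of "T - A" T] by auto
qed

section \<open>Capacitability of analytic sets\<close>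

text \<open>Only the first \<open>n\<close> values of \<open>x\<close> and \<open>f\<close> may matter for \<open>P n x f\<close>, so \<open>\<forall>n. P n x f\<close>
  is a closed condition on \<open>(x, f)\<close>.\<close>
definition initial_segment_pred :: "(nat \<Rightarrow> (nat \<Rightarrow> bool) \<Rightarrow> (nat \<Rightarrow> nat) \<Rightarrow> bool) \<Rightarrow> bool" where
  "initial_segment_pred P \<longleftrightarrow>
     (\<forall>n x f y g. (\<forall>i<n. x i = y i \<and> f i = g i) \<longrightarrow> P n x f \<longrightarrow> P n y g)"

text \<open>The boldface class: projections of closed subsets of the product of Cantor space with
  Baire space.\<close>

definition analytic :: "(nat \<Rightarrow> bool) set \<Rightarrow> bool" where
  "analytic A \<longleftrightarrow> (\<exists>P. initial_segment_pred P \<and> A = {x. \<exists>f. \<forall>n. P n x f})"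

lemma initial_segment_predD:
  "\<lbrakk>initial_segment_pred P; \<And>i. i < n \<Longrightarrow> x i = y i; \<And>i. i < n \<Longrightarrow> f i = g i; P n x f\<rbrakk> \<Longrightarrow> P n y g"
  unfolding initial_segment_pred_def by blast

lemma analytic_if_lightface_sigma11:
  assumes "lightface_sigma11 E"
  shows "analytic E"
proof -
  obtain R where E: "E = {x. \<exists>f. \<forall>n. R (code_bits x n) (code_seq f n)}"
    using assms unfolding lightface_sigma11_def by blast
  have "code_bits x n = code_bits y n" if "\<forall>i<n. x i = y i \<and> f i = g i"
    for x y n and f g :: "nat \<Rightarrow> nat"
    unfolding code_bits_def using that by (intro arg_cong[of _ _ list_encode] map_cong) auto
  moreover have "code_seq f n = code_seq g n" if "\<forall>i<n. x i = y i \<and> f i = g i"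
    for x y :: "nat \<Rightarrow> bool" and n f g
    unfolding code_seq_def using that by (intro arg_cong[of _ _ list_encode] map_cong) auto
  ultimately have "initial_segment_pred (\<lambda>n x f. R (code_bits x n) (code_seq f n))"
    unfolding initial_segment_pred_def by metis
  then show ?thesis unfolding analytic_def E by blast
qed

lemma analytic_Int_cyl:
  assumes "analytic A"
  shows "analytic (A \<inter> cyl \<sigma>)"
proof -
  obtain P where P: "initial_segment_pred P" "A = {x. \<exists>f. \<forall>n. P n x f}"
    using assms unfolding analytic_def by blast
  \<comment> \<open>The test for \<open>cyl \<sigma>\<close> is placed at
    \<open>n = length \<sigma>\<close>, where the first \<open>n\<close> values of \<open>x\<close>
    decide it.\<close>
  define P' where "P' n x f \<longleftrightarrow> P n x f \<and> (n = length \<sigma> \<longrightarrow> prefix_of x n = \<sigma>)" for n x f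
  have "initial_segment_pred P'"
    unfolding initial_segment_pred_def
  proof (intro allI impI)
    fix n x f y g assume eq: "\<forall>i<n. x i = y i \<and> f i = g i" and "P' n x f"
    have "prefix_of x n = prefix_of y n" unfolding prefix_of_eq_iff using eq by blast
    moreover have "P n y g"
      using initial_segment_predD[OF P(1), of n x y f g] eq \<open>P' n x f\<close> unfolding P'_def by blast
    ultimately show "P' n y g" using \<open>P' n x f\<close> unfolding P'_def by metis
  qed
  moreover have "A \<inter> cyl \<sigma> = {x. \<exists>f. \<forall>n. P' n x f}"
    unfolding P(2) P'_def cyl_def by auto
  ultimately show ?thesis unfolding analytic_def by blast
qed

section \<open>Diagonal choice, and compactness for bounded witnesses\<close>

text \<open>Values are chosen one at a time by dependent choice. As \<open>Q n\<close> looks only at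
  the first \<open>n\<close> values, which later stages leave alone, it passes to the
  diagonal.\<close>

lemma diagonal_function:
  fixes Q :: "nat \<Rightarrow> (nat \<Rightarrow> 'a) \<Rightarrow> bool"
  assumes local: "\<And>n f g. (\<And>i. i < n \<Longrightarrow> f i = g i) \<Longrightarrow> Q n f \<Longrightarrow> Q n g"
    and base: "\<And>f. Q 0 f"
    and step: "\<And>n f. Q n f \<Longrightarrow> \<exists>a. Q (Suc n) (f(n := a))"
  obtains g where "\<And>n. Q n g"
proof -
  have "\<exists>G. \<forall>n. Q n (G n) \<and> (\<forall>i<n. G (Suc n) i = G n i)"
  proof (rule dependent_nat_choice)
    fix f n assume "Q n f"
    then obtain a where "Q (Suc n) (f(n := a))" using step by blast
    then show "\<exists>g. Q (Suc n) g \<and> (\<forall>i<n. g i = f i)" by (intro exI[of _ "f(n := a)"]) auto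
  qed (use base in blast)
  then obtain G where G: "\<And>n. Q n (G n)" "\<And>n i. i < n \<Longrightarrow> G (Suc n) i = G n i" by blast
  \<comment> \<open>The value at \<open>i\<close> is frozen from stage \<open>Suc i\<close> on, so
    the diagonal reads it off there.\<close>
  have agree: "G n i = G (Suc i) i" if "Suc i \<le> n" for n i
    using that by (induction n rule: dec_induct) (simp_all add: G(2))
  have "Q n (\<lambda>i. G (Suc i) i)" for n
    by (rule local[OF _ G(1)]) (use agree[of _ n] in \<open>auto simp: Suc_le_eq\<close>)
  then show thesis by (rule that)
qed

text \<open>Sequential compactness of a product of finite sets: infinitely many indices agree with
  the part of \<open>g\<close> built so far, and the pigeonhole principle keeps infinitely many of
  them for the next value.\<close>

lemma bounded_cluster_point:
  fixes h :: "nat \<Rightarrow> nat \<Rightarrow> nat"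
  assumes bound: "\<And>m i. i < m \<Longrightarrow> h m i \<le> b i"
  obtains g where "\<And>n. \<exists>m\<ge>n. \<forall>i<n. h m i = g i" "\<And>i. g i \<le> b i"
proof -
  obtain g where g: "\<And>n. infinite {m. \<forall>i<n. h m i = g i}"
  proof (rule diagonal_function[of "\<lambda>n g. infinite {m. \<forall>i<n. h m i = g i}"])
    fix n f assume inf: "infinite {m. \<forall>i<n. h m i = f i}"
    \<comment> \<open>The bound on \<open>h m n\<close> is known only for \<open>n < m\<close>, so
      the indices up to \<open>n\<close> are removed before the pigeonhole argument.\<close>
    define S where "S = {m. \<forall>i<n. h m i = f i} - {..n}"
    have "infinite S" unfolding S_def using inf by (simp add: Diff_infinite_finite)
    moreover have "(\<lambda>m. h m n) ` S \<subseteq> {..b n}" by (auto simp: S_def not_le intro!: bound)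
    then have "finite ((\<lambda>m. h m n) ` S)" using finite_subset by blast
    ultimately obtain m0 where "infinite {m \<in> S. h m n = h m0 n}"
      using pigeonhole_infinite[of S "\<lambda>m. h m n"] by blast
    moreover have "{m \<in> S. h m n = h m0 n} \<subseteq> {m. \<forall>i<Suc n. h m i = (f(n := h m0 n)) i}"
      by (auto simp: S_def less_Suc_eq)
    ultimately show "\<exists>a. infinite {m. \<forall>i<Suc n. h m i = (f(n := a)) i}"
      using infinite_super by blast
  qed auto
  have cluster: "\<exists>m\<ge>n. \<forall>i<n. h m i = g i" for n
    using g[of n] unfolding infinite_nat_iff_unbounded_le by auto
  show thesis
  proof (rule that[OF cluster])
    fix i
    obtain m where "m \<ge> Suc i" "h m i = g i" using cluster[of "Suc i"] by blast
    then show "g i \<le> b i" using bound[of i m] by simp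
  qed
qed

text \<open>A cluster point of the pairs \<open>(x m, f m)\<close> satisfies every
  \<open>P n\<close>, because \<open>P n\<close> sees only finitely many values and some pair agrees
  with the limit on those. This serves both to show that a set is closed and to extract a finite
  stage from a cover.\<close>

lemma bounded_witness_limit:
  fixes x :: "nat \<Rightarrow> nat \<Rightarrow> bool" and f :: "nat \<Rightarrow> nat \<Rightarrow> nat"
  assumes P: "initial_segment_pred P"
    and bound: "\<And>m i. i < m \<Longrightarrow> f m i \<le> b i"
    and wit: "\<And>m n. P n (x m) (f m)"
  obtains y g where "\<And>i. g i \<le> b i" "\<And>n. P n y g" "\<And>n. \<exists>m\<ge>n. prefix_of (x m) n = prefix_of y n"
proof -
  \<comment> \<open>Each pair is packed into one sequence, with \<open>x\<close> as the parity and
    \<open>f\<close> as the half, so that a single cluster point handles both.\<close>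
  define h where "h m i = 2 * f m i + of_bool (x m i)" for m i
  have "h m i \<le> 2 * b i + 1" if "i < m" for m i
    using bound[OF that] by (auto simp: h_def)
  then obtain G where G: "\<And>n. \<exists>m\<ge>n. \<forall>i<n. h m i = G i" "\<And>i. G i \<le> 2 * b i + 1"
    using bounded_cluster_point[of h "\<lambda>i. 2 * b i + 1"] by blast
  have f: "f m i = h m i div 2" and x: "x m i = odd (h m i)" for m i by (auto simp: h_def)
  define y g where "y i = odd (G i)" and "g i = G i div 2" for i
  have cluster: "\<exists>m\<ge>n. prefix_of (x m) n = prefix_of y n \<and> (\<forall>i<n. f m i = g i)" for n
  proof -
    obtain m where "m \<ge> n" "\<forall>i<n. h m i = G i" using G(1) by blast
    then show ?thesis by (intro exI[of _ m]) (simp add: f x prefix_of_eq_iff y_def g_def)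
  qed
  show thesis
  proof (rule that)
    show "g i \<le> b i" for i using G(2)[of i] unfolding g_def by linarith
  next
    fix n
    obtain m where m: "prefix_of (x m) n = prefix_of y n" "\<forall>i<n. f m i = g i"
      using cluster[of n] by blast
    show "P n y g"
    proof (rule initial_segment_predD[OF P, of n "x m" y "f m" g])
      show "x m i = y i" if "i < n" for i using m(1) that by (rule prefix_of_eqD)
    qed (use m(2) wit in simp_all)
  next
    show "\<exists>m\<ge>n. prefix_of (x m) n = prefix_of y n" for n
      using cluster[of n] by blast
  qed
qed

text \<open>Bounds \<open>g i\<close> on the witness values are fixed one by one, the increasing
  sets lemma keeping the content above \<open>c\<close>. The points having a witness below
  \<open>g\<close> everywhere form a compact set, and compactness carries the content bound over to
  it.\<close>

theorem analytic_capacitable: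
  assumes "analytic A" and c: "c < net_content s k A"
  obtains K where "K \<subseteq> A" "cantor_closed K" "c \<le> net_content s k K"
proof -
  obtain P where P: "initial_segment_pred P" and A: "A = {x. \<exists>f. \<forall>n. P n x f}"
    using assms unfolding analytic_def by blast
  define B where "B m g = {x. \<exists>f. (\<forall>i<m. f i \<le> g i) \<and> (\<forall>n. P n x f)}" for m :: nat and g :: "nat \<Rightarrow> nat"
  have B_cong: "B m f = B m g" if "\<And>i. i < m \<Longrightarrow> f i = g i" for m f g
    using that by (simp add: B_def)
  obtain g where g: "\<And>m. c < net_content s k (B m g)"
  proof (rule diagonal_function[of "\<lambda>m g. c < net_content s k (B m g)"])
    fix n f g assume "\<And>i. i < n \<Longrightarrow> f i = (g i :: nat)" "c < net_content s k (B n f)"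
    then show "c < net_content s k (B n g)" using B_cong[of n f g] by simp
  next
    \<comment> \<open>No value is bounded at stage 0, so \<open>B 0 f\<close> is
      \<open>A\<close>.\<close>
    show "c < net_content s k (B 0 f)" for f using c by (simp add: B_def A)
  next
    fix n f assume less: "c < net_content s k (B n f)"
    \<comment> \<open>Every witness has some value at \<open>n\<close>, so the bounds
      \<open>a\<close> at \<open>n\<close> exhaust \<open>B n f\<close>. The union increases with
      \<open>a\<close>, hence one \<open>a\<close> must already have content above
      \<open>c\<close>.\<close>
    have "B n f \<subseteq> (\<Union>a. B (Suc n) (f(n := a)))"
    proof
      fix x assume "x \<in> B n f"
      then obtain w where "\<forall>i<n. w i \<le> f i" "\<forall>n. P n x w" unfolding B_def by blast
      then have "x \<in> B (Suc n) (f(n := w n))" by (auto simp: B_def less_Suc_eq)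
      then show "x \<in> (\<Union>a. B (Suc n) (f(n := a)))" by blast
    qed
    then have "net_content s k (B n f) \<le> net_content s k (\<Union>a. B (Suc n) (f(n := a)))"
      by (rule net_content_mono)
    moreover have "incseq (\<lambda>a. B (Suc n) (f(n := a)))"
      unfolding incseq_def
    proof (intro allI impI subsetI)
      fix a a' x assume "a \<le> a'" "x \<in> B (Suc n) (f(n := a))"
      then obtain w where "\<forall>i<Suc n. w i \<le> (f(n := a)) i" "\<forall>n. P n x w" unfolding B_def by blast
      moreover from this(1) \<open>a \<le> a'\<close> have "\<forall>i<Suc n. w i \<le> (f(n := a')) i"
        by (auto simp: less_Suc_eq)
      ultimately show "x \<in> B (Suc n) (f(n := a'))" unfolding B_def by blast
    qed
    ultimately show "\<exists>a. c < net_content s k (B (Suc n) (f(n := a)))"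
      using net_content_UN_incseq_le[of "\<lambda>a. B (Suc n) (f(n := a))" s k c] less
      by (meson not_le order_trans)
  qed (rule that)
  define K where "K = {x. \<exists>f. (\<forall>i. f i \<le> g i) \<and> (\<forall>n. P n x f)}"
  show thesis
  proof (rule that)
    show "K \<subseteq> A" by (auto simp: K_def A)
    show "cantor_closed K"
      unfolding cantor_closed_iff
    proof (intro allI impI)
      fix x assume "\<forall>n. \<exists>y\<in>K. prefix_of y n = prefix_of x n"
      then obtain y where y: "\<And>n. y n \<in> K" "\<And>n. prefix_of (y n) n = prefix_of x n" by metis
      from y(1) have "\<forall>n. \<exists>f. (\<forall>i. f i \<le> g i) \<and> (\<forall>m. P m (y n) f)" unfolding K_def by simp
      then obtain f where f: "\<And>n i. f n i \<le> g i" "\<And>m n. P m (y n) (f n)" by metis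
      obtain z w where zw: "\<And>i. w i \<le> g i" "\<And>n. P n z w" "\<And>n. \<exists>m\<ge>n. prefix_of (y m) n = prefix_of z n"
        by (rule bounded_witness_limit[where f = f and x = y and b = g, OF P f]) (rule that)
      have "prefix_of z n = prefix_of x n" for n
        using zw(3)[of n] y(2) prefix_of_eq_mono by metis
      then have "z i = x i" for i by (rule prefix_of_eqD) (rule lessI)
      then have "z = x" by (rule ext)
      then show "x \<in> K" using zw(1,2) unfolding K_def by blast
    qed
    show "c \<le> net_content s k K"
    proof (rule net_content_greatest)
      fix Q assume Q: "\<forall>\<sigma>\<in>Q. k \<le> length \<sigma>" "K \<subseteq> cyls Q"
      \<comment> \<open>Uncovered points \<open>x m\<close> of \<open>B m g\<close> would have a
        cluster point \<open>z\<close> in \<open>K\<close>. A prefix of \<open>z\<close> belongs to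
        \<open>Q\<close> and is shared by some \<open>x m\<close>, which would then be
        covered.\<close>
      have "\<exists>m. B m g \<subseteq> cyls Q"
      proof (rule ccontr)
        assume "\<nexists>m. B m g \<subseteq> cyls Q"
        then have "\<forall>m. \<exists>x. x \<in> B m g \<and> x \<notin> cyls Q" by blast
        then obtain x where x: "\<And>m. x m \<in> B m g" "\<And>m. x m \<notin> cyls Q" by metis
        from x(1) have "\<forall>m. \<exists>f. (\<forall>i<m. f i \<le> g i) \<and> (\<forall>n. P n (x m) f)" unfolding B_def by simp
        then obtain f where f: "\<And>m i. i < m \<Longrightarrow> f m i \<le> g i" "\<And>m n. P n (x m) (f m)" by metis
        obtain z w where zw: "\<And>i. w i \<le> g i" "\<And>n. P n z w" "\<And>n. \<exists>m\<ge>n. prefix_of (x m) n = prefix_of z n"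
          by (rule bounded_witness_limit[where f = f and x = x and b = g, OF P f]) (assumption, rule that)
        have "z \<in> cyls Q" using zw(1,2) Q(2) unfolding K_def by blast
        then obtain n where "prefix_of z n \<in> Q" by (auto simp: cyls_def)
        moreover obtain m where "prefix_of (x m) n = prefix_of z n" using zw(3) by blast
        ultimately have "x m \<in> cyls Q" unfolding cyls_def by (metis mem_Collect_eq)
        with x(2) show False by blast
      qed
      then obtain m where "B m g \<subseteq> cyls Q" by blast
      then have "net_content s k (B m g) \<le> cost s Q" using Q(1) by (intro net_content_le) auto
      with g[of m] show "c \<le> cost s Q" by simp
    qed
  qed
qed

lemma analytic_closed_subset:
  assumes s: "0 < s" and "analytic A" and "c < hausdorff s A"
  obtains K where "K \<subseteq> A" "cantor_closed K" "c \<le> hausdorff s K"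
proof -
  obtain k where "c < net_content s k A"
    using assms(3) unfolding hausdorff_eq_SUP_net_content[OF s] less_SUP_iff by blast
  then obtain K where "K \<subseteq> A" "cantor_closed K" "c \<le> net_content s k K"
    using analytic_capacitable[OF assms(2)] by metis
  then show thesis using that net_content_le_hausdorff[OF s, of k K] order_trans by blast
qed

text \<open>Up to a null set, an analytic set of finite measure is a countable union of closed sets.\<close>
lemma hausdorff_measurable_analytic:
  assumes s: "0 < s" and A: "analytic A" and fin: "hausdorff s A < \<infinity>"
  shows "hausdorff_measurable s A"
proof -
  interpret sigma_algebra UNIV "{A. hausdorff_measurable s A}"
    by (rule sigma_algebra_hausdorff_measurable[OF s])
  define \<K> where "\<K> = {K. K \<subseteq> A \<and> cantor_closed K}"
  have "{} \<in> \<K>" by (simp add: \<K>_def cantor_closed_iff)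
  \<comment> \<open>Countably many closed subsets of \<open>A\<close> suffice to approach the
    supremum of the measures of all of them.\<close>
  then obtain F where F: "range F \<subseteq> hausdorff s ` \<K>" "(SUP K\<in>\<K>. hausdorff s K) = (SUP n :: nat. F n)"
    using ennreal_SUP_countable_SUP[of \<K> "hausdorff s"] by blast
  then have "\<forall>n. \<exists>K\<in>\<K>. F n = hausdorff s K" by blast
  then obtain K where K: "\<And>n. K n \<in> \<K>" "\<And>n. F n = hausdorff s (K n)" by metis
  define U where "U = (\<Union>n. K n)"
  have "U \<subseteq> A" using K(1) unfolding U_def \<K>_def by blast
  have "hausdorff_measurable s U"
    using countable_UN[of K UNIV] K(1) hausdorff_measurable_closed[OF s]
    unfolding U_def \<K>_def by (auto simp: image_subset_iff)
  have "hausdorff s A \<le> (SUP K\<in>\<K>. hausdorff s K)"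
  proof (rule ccontr)
    assume "\<not> ?thesis"
    then obtain c where c: "(SUP K\<in>\<K>. hausdorff s K) < c" "c < hausdorff s A"
      using dense by (metis not_le)
    obtain L where "L \<subseteq> A" "cantor_closed L" "c \<le> hausdorff s L"
      using analytic_closed_subset[OF s A c(2)] .
    then have "c \<le> (SUP K\<in>\<K>. hausdorff s K)"
      by (intro SUP_upper2[of L]) (auto simp: \<K>_def)
    with c(1) show False by simp
  qed
  also have "\<dots> \<le> hausdorff s U"
    unfolding F(2) K(2) by (intro SUP_least hausdorff_mono[OF s]) (auto simp: U_def)
  finally have "hausdorff s A \<le> hausdorff s U" .
  \<comment> \<open>Measurability of \<open>U\<close> splits \<open>A\<close>; as \<open>U\<close>
    has finite measure no smaller than that of \<open>A\<close>, the remainder is null.\<close>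
  moreover have "hausdorff s A = hausdorff s U + hausdorff s (A - U)"
    using \<open>hausdorff_measurable s U\<close>[unfolded hausdorff_measurable_def, THEN spec, of A]
    unfolding Int_absorb1[OF \<open>U \<subseteq> A\<close>] .
  ultimately have "hausdorff s U + hausdorff s (A - U) \<le> hausdorff s U + 0" by simp
  moreover have "hausdorff s U < \<infinity>"
    using hausdorff_mono[OF s \<open>U \<subseteq> A\<close>] fin by simp
  ultimately have "hausdorff s (A - U) = 0"
    unfolding ennreal_add_left_cancel_le by auto
  then have "hausdorff_measurable s (A - U)" by (rule hausdorff_measurable_null[OF s])
  moreover have "A = U \<union> (A - U)" using \<open>U \<subseteq> A\<close> by blast
  ultimately show ?thesis
    using Un[of U "A - U"] \<open>hausdorff_measurable s U\<close> by (simp only: mem_Collect_eq)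
qed

section \<open>Closed sets accumulating at one point, and the final construction\<close>

lemma cantor_closed_finite_UN:
  fixes m :: nat
  assumes closed: "\<And>j. j < m \<Longrightarrow> cantor_closed (K j)"
  shows "cantor_closed (\<Union>j<m. K j)"
  unfolding cantor_closed_iff
proof (intro allI impI, rule ccontr)
  fix x assume near: "\<forall>n. \<exists>y\<in>(\<Union>j<m. K j). prefix_of y n = prefix_of x n"
    and "x \<notin> (\<Union>j<m. K j)"
  then have "\<forall>j. \<exists>n. j < m \<longrightarrow> (\<forall>y\<in>K j. prefix_of y n \<noteq> prefix_of x n)"
    using cantor_closed_separated[OF closed] by auto
  then obtain N where N: "\<And>j y. j < m \<Longrightarrow> y \<in> K j \<Longrightarrow> prefix_of y (N j) \<noteq> prefix_of x (N j)" by metis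
  \<comment> \<open>The sum serves as a common upper bound for the separating lengths
    \<open>N j\<close>.\<close>
  define M where "M = (\<Sum>j<m. N j)"
  obtain j y where y: "j < m" "y \<in> K j" "prefix_of y M = prefix_of x M" using near by blast
  have "N j \<le> M" unfolding M_def by (rule member_le_sum) (use y(1) in auto)
  with N[OF y(1,2)] prefix_of_eq_mono[OF y(3)] show False by blast
qed

text \<open>If \<open>y\<close> differs from \<open>x\<close> before place \<open>m\<close>, then
  points close to \<open>y\<close> avoid \<open>x\<close> and every \<open>K j\<close> with
  \<open>m \<le> j\<close>. Only the finite union over \<open>j < m\<close> is left, and that is
  closed.\<close>

lemma cantor_closed_insert_UN:
  assumes closed: "\<And>n. cantor_closed (K n)" and sub: "\<And>n. K n \<subseteq> cyl (prefix_of x n)"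
  shows "cantor_closed (insert x (\<Union>n. K n))"
  unfolding cantor_closed_iff
proof (intro allI impI)
  fix y assume near: "\<forall>n. \<exists>z\<in>insert x (\<Union>n. K n). prefix_of z n = prefix_of y n"
  show "y \<in> insert x (\<Union>n. K n)"
  proof (cases "\<exists>m. prefix_of x m \<noteq> prefix_of y m")
    case True
    then obtain m where m: "prefix_of x m \<noteq> prefix_of y m" by blast
    have "\<exists>z\<in>(\<Union>j<m. K j). prefix_of z n = prefix_of y n" for n
    proof -
      obtain z where z: "z \<in> insert x (\<Union>n. K n)" "prefix_of z (max m n) = prefix_of y (max m n)"
        using near by blast
      have zm: "prefix_of z m = prefix_of y m" and zn: "prefix_of z n = prefix_of y n"
        using prefix_of_eq_mono[OF z(2)] by simp_all
      have "z \<noteq> x" using zm m by auto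
      then obtain j where j: "z \<in> K j" using z(1) by blast
      then have "prefix_of z j = prefix_of x j" using sub[of j] by (auto simp: mem_cyl_prefix)
      then have "j < m" using prefix_of_eq_mono[of z j x m] zm m by (cases "j < m") simp_all
      with j zn show ?thesis by blast
    qed
    then have "y \<in> (\<Union>j<m. K j)"
      using cantor_closed_separated[OF cantor_closed_finite_UN[of m K, OF closed], of y] by blast
    then show ?thesis by blast
  next
    case False
    then have "prefix_of y (Suc i) = prefix_of x (Suc i)" for i by simp
    then have "y i = x i" for i by (rule prefix_of_eqD) (rule lessI)
    then have "y = x" by (rule ext)
    then show ?thesis by blast
  qed
qed

theorem mainTheorem2:
  fixes s :: real and E :: "(nat \<Rightarrow> bool) set"
  assumes "s > 0"
    and "lightface_sigma11 E"
    and "\<not> hausdorff_sigma_finite s E"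
  shows "\<exists>C. C \<subseteq> E \<and> cantor_closed C \<and> hausdorff s C = \<infinity>"
proof -
  have E: "analytic (E \<inter> cyl \<sigma>)" for \<sigma>
    using assms(2) by (intro analytic_Int_cyl analytic_if_lightface_sigma11)
  obtain x where x: "x \<in> E" "\<And>n. hausdorff s (E \<inter> cyl (prefix_of x n)) = \<infinity>"
  proof (rule ccontr)
    assume "\<not> thesis"
    with that have ex: "\<exists>n. hausdorff s (E \<inter> cyl (prefix_of x n)) < \<infinity>" if "x \<in> E" for x
      using \<open>x \<in> E\<close> by (metis infinity_ennreal_def less_top)
    \<comment> \<open>There are countably many cylinders. Those meeting \<open>E\<close> in infinite
      measure are replaced by the empty set, and by \<open>ex\<close> the others still cover
      \<open>E\<close>.\<close>
    define A where "A i = (let \<sigma> = from_nat i in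
      if hausdorff s (E \<inter> cyl \<sigma>) < \<infinity> then E \<inter> cyl \<sigma> else {})" for i :: nat
    have "E \<subseteq> (\<Union>i. A i)"
    proof
      fix x assume "x \<in> E"
      then obtain n where "hausdorff s (E \<inter> cyl (prefix_of x n)) < \<infinity>" using ex by blast
      then have "x \<in> A (to_nat (prefix_of x n))"
        using \<open>x \<in> E\<close> by (simp add: A_def mem_cyl_prefix)
      then show "x \<in> (\<Union>i. A i)" by blast
    qed
    then have "E = (\<Union>i. A i)" by (auto simp: A_def Let_def split: if_splits)
    moreover have "hausdorff_measurable s (A i) \<and> hausdorff s (A i) < \<infinity>" for i
      using hausdorff_measurable_analytic[OF assms(1) E] hausdorff_empty[OF assms(1)]
        hausdorff_measurable_null[OF assms(1), of "{}"]
      by (auto simp: A_def Let_def)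
    ultimately show False using assms(3) unfolding hausdorff_sigma_finite_def by blast
  qed
  have "\<exists>K. K \<subseteq> E \<inter> cyl (prefix_of x n) \<and> cantor_closed K \<and> of_nat n \<le> hausdorff s K" for n
    using analytic_closed_subset[OF assms(1) E, of "of_nat n" "prefix_of x n"] x(2)
    by (metis infinity_ennreal_def of_nat_less_top)
  then obtain K where K: "\<And>n. K n \<subseteq> E \<inter> cyl (prefix_of x n)" "\<And>n. cantor_closed (K n)"
      "\<And>n. of_nat n \<le> hausdorff s (K n)"
    by metis
  define C where "C = insert x (\<Union>n. K n)"
  have "C \<subseteq> E" using K(1) x(1) unfolding C_def by blast
  moreover have "cantor_closed C"
    unfolding C_def using K(1,2) by (intro cantor_closed_insert_UN) auto
  moreover have "hausdorff s C = \<infinity>"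
  proof -
    have "of_nat n \<le> hausdorff s C" for n
      using K(3)[of n] hausdorff_mono[OF assms(1), of "K n" C] by (auto simp: C_def intro: order_trans)
    then have "(SUP n. of_nat n) \<le> hausdorff s C" by (rule SUP_least)
    then show ?thesis by (simp add: ennreal_SUP_of_nat_eq_top top_unique)
  qed
  ultimately show ?thesis by blast
qed

end
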